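(* Let $n\ge 2$, let $K,L\in\mathcal S^n$ be star bodies in $\mathbb R^n$, let $i$ be an integer with $0\le i<n$, and let $\phi_1,\phi_2\in\Phi$. For $\varepsilon>0$ let $K\check{+}_\phi\varepsilon\cdot L$ be the Orlicz chord linear combination, i.e. a star body whose half-chord function satisfies $$\phi_1\!\left(\frac{d(K,u)}{d(K\check{+}_\phi\varepsilon\cdot L,u)}\right)+\varepsilon\,\phi_2\!\left(\frac{d(L,u)}{d(K\check{+}_\phi\varepsilon\cdot L,u)}\right)=1\quad\text{for all }u\in S^{n-1}.$$ Then the limit below exists and $$\frac{(\phi_1)'_r(1)}{n-i}\,\lim_{\varepsilon\to0^+}\frac{B_i(K\check{+}_\phi\varepsilon\cdot L)-B_i(K)}{\varepsilon}=\frac1n\int_{S^{n-1}}\phi_2\!\left(\frac{d(L,u)}{d(K,u)}\right)d(K,u)^{n-i}\,dS(u),$$ where $(\phi_1)'_r(1)$ is the right derivative of $\phi_1$ at $1$.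
   Context: $S^{n-1}$ is the unit sphere of $\mathbb R^n$ and $dS$ is its spherical Lebesgue measure. For a compact set $K\subset\mathbb R^n$ that contains the origin and is star-shaped with respect to it, the radial function is $\rho(K,u)=\max\{c\ge 0: cu\in K\}$, $u\in S^{n-1}$. $K$ is a star body if $\rho(K,\cdot)$ is positive and continuous on $S^{n-1}$; $\mathcal S^n$ is the set of star bodies. The half chord of $K$ in direction $u$ is $d(K,u)=\tfrac12(\rho(K,u)+\rho(K,-u))$. The chord integral is $B_i(K)=\frac1n\int_{S^{n-1}}d(K,u)^{n-i}\,dS(u)$; it depends on $K$ only through $d(K,\cdot)$. The Orlicz chord linear combination is specified only through its half-chord function, which is uniquely determined by the displayed equation. $\Phi$ is the set of convex functions $\phi:[0,\infty)\to(0,\infty]$, finite on $(0,\infty)$, that are strictly decreasing and satisfy $\phi(0)=\infty$, $\phi(1)=1$ and $\lim_{t\to\infty}\phi(t)=0$. *)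

theory Defs
  imports "HOL-Analysis.Analysis"
begin

(* Spherical Lebesgue measure on S^(n-1), as a Borel measure: n times the Lebesgue measure of the
   truncated cone over a set (see emeasure_sphere_measure).  This is the normalisation of polar
   coordinates, dx = r^(n-1) dr dS(u). *)
definition sphere_measure :: "(real^'n) measure" where
  "sphere_measure =
     scale_measure (of_nat CARD('n))
       (distr (restrict_space lborel (cball 0 1 - {0})) (restrict_space borel (sphere 0 1))
          (\<lambda>x. x /\<^sub>R norm x))"

lemma space_sphere_measure [simp]: "space (sphere_measure :: (real^'n) measure) = sphere 0 1"
  by (simp add: sphere_measure_def space_scale_measure space_restrict_space)

lemma sets_sphere_measure [simp, measurable_cong]:
  "sets (sphere_measure :: (real^'n) measure) = sets (restrict_space borel (sphere 0 1))"
  by (simp add: sphere_measure_def)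

lemma emeasure_sphere_measure:
  fixes A :: "(real^'n) set"
  assumes "A \<in> sets sphere_measure"
  shows "emeasure sphere_measure A =
           of_nat CARD('n) * emeasure lborel {r *\<^sub>R u |r u. 0 < r \<and> r \<le> 1 \<and> u \<in> A}"
proof -
  let ?g = "\<lambda>x::real^'n. x /\<^sub>R norm x"
  let ?D = "restrict_space lborel (cball 0 1 - {0::real^'n})"
  have sub: "A \<subseteq> sphere 0 1"
    using sets.sets_into_space[OF assms] by simp
  have g: "?g \<in> measurable ?D (restrict_space borel (sphere 0 1))"
  proof (rule measurable_restrict_space2)
    show "?g \<in> space ?D \<rightarrow> sphere 0 1"
      by (auto simp: space_restrict_space)
    show "?g \<in> borel_measurable ?D"
      by (rule measurable_restrict_space1) measurable
  qed
  have eq: "?g -` A \<inter> space ?D = {r *\<^sub>R u |r u. 0 < r \<and> r \<le> 1 \<and> u \<in> A}"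
  proof (intro equalityI subsetI)
    fix x assume x: "x \<in> ?g -` A \<inter> space ?D"
    hence "x = norm x *\<^sub>R ?g x \<and> 0 < norm x \<and> norm x \<le> 1 \<and> ?g x \<in> A"
      by (auto simp: space_restrict_space)
    thus "x \<in> {r *\<^sub>R u |r u. 0 < r \<and> r \<le> 1 \<and> u \<in> A}"
      by blast
  next
    fix x assume "x \<in> {r *\<^sub>R u |r u. 0 < r \<and> r \<le> 1 \<and> u \<in> A}"
    then obtain r u where "x = r *\<^sub>R u" "0 < r" "r \<le> 1" "u \<in> A" by blast
    moreover from this sub have "norm u = 1" by auto
    ultimately show "x \<in> ?g -` A \<inter> space ?D"
      by (auto simp: space_restrict_space)
  qed
  have "emeasure sphere_measure A = of_nat CARD('n) * emeasure ?D (?g -` A \<inter> space ?D)"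
    using assms g by (simp add: sphere_measure_def emeasure_distr)
  also have "emeasure ?D (?g -` A \<inter> space ?D) = emeasure lborel (?g -` A \<inter> space ?D)"
    by (rule emeasure_restrict_space) (auto simp: space_restrict_space)
  finally show ?thesis
    by (simp only: eq)
qed

definition radial :: "(real^'n) set \<Rightarrow> real^'n \<Rightarrow> real" where
  "radial K u = (GREATEST c. 0 \<le> c \<and> c *\<^sub>R u \<in> K)"

definition star_body :: "(real^'n) set \<Rightarrow> bool" where
  "star_body K \<longleftrightarrow>
     compact K \<and> 0 \<in> K \<and> (\<forall>x\<in>K. closed_segment 0 x \<subseteq> K) \<and>
     (\<forall>u\<in>sphere 0 1. 0 < radial K u) \<and> continuous_on (sphere 0 1) (radial K)"

definition half_chord :: "(real^'n) set \<Rightarrow> real^'n \<Rightarrow> real" where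
  "half_chord K u = (radial K u + radial K (- u)) / 2"

definition chord_integral :: "nat \<Rightarrow> (real^'n) set \<Rightarrow> real" where
  "chord_integral i K =
     1 / CARD('n) * (\<integral>u. half_chord K u ^ (CARD('n) - i) \<partial>sphere_measure)"

(* The class of Orlicz functions from [0,\<infinity>) to (0,\<infinity>]; values at negative arguments are irrelevant.
   In the convexity inequality, the ereal convention 0 * \<infinity> = 0 covers the endpoint cases. *)
definition orlicz_class :: "(real \<Rightarrow> ereal) set" where
  "orlicz_class = {\<phi>.
     (\<forall>x\<ge>0. 0 < \<phi> x) \<and> (\<forall>x>0. \<phi> x < \<infinity>) \<and>
     (\<forall>x\<ge>0. \<forall>y\<ge>0. \<forall>t\<in>{0..1}.
        \<phi> ((1 - t) * x + t * y) \<le> ereal (1 - t) * \<phi> x + ereal t * \<phi> y) \<and>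
     strict_antimono_on {0..} \<phi> \<and> \<phi> 0 = \<infinity> \<and> \<phi> 1 = 1 \<and> (\<phi> \<longlongrightarrow> 0) at_top}"

(* The equation determines only the half-chord function of M, not M itself. *)
definition orlicz_chord_combination ::
    "(real \<Rightarrow> ereal) \<Rightarrow> (real \<Rightarrow> ereal) \<Rightarrow> (real^'n) set \<Rightarrow> real \<Rightarrow> (real^'n) set \<Rightarrow> (real^'n) set \<Rightarrow> bool"
where
  "orlicz_chord_combination \<phi>1 \<phi>2 K \<epsilon> L M \<longleftrightarrow>
     star_body M \<and>
     (\<forall>u\<in>sphere 0 1. \<phi>1 (half_chord K u / half_chord M u)
        + ereal \<epsilon> * \<phi>2 (half_chord L u / half_chord M u) = 1)"

definition right_deriv :: "(real \<Rightarrow> ereal) \<Rightarrow> real \<Rightarrow> real" where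
  "right_deriv \<phi> x = Lim (at_right x) (\<lambda>t. (real_of_ereal (\<phi> t) - real_of_ereal (\<phi> x)) / (t - x))"

end

theory Submission
  imports Defs
begin

text \<open>Write \<open>a\<close>, \<open>b\<close>, \<open>x\<close> for the half chords of \<open>K\<close>, \<open>L\<close>, \<open>M \<epsilon>\<close> in a fixed direction, \<open>m = n - i\<close>,
  and put \<open>c = 1 - \<phi>\<^sub>1 2 > 0\<close>. The defining equation forces \<open>x < a\<close>, hence
  \<open>1 - \<phi>\<^sub>1 (a / x) = \<epsilon> \<phi>\<^sub>2 (b / x) \<le> \<epsilon> \<phi>\<^sub>2 (b / a)\<close>, and convexity of \<open>\<phi>\<^sub>1\<close> turns this into
  \<open>c (1 - x / a) \<le> \<epsilon> \<phi>\<^sub>2 (b / a)\<close>. So \<open>x\<close> tends to \<open>a\<close>, the quotient \<open>(x\<^sup>m - a\<^sup>m) / \<epsilon>\<close> tends to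
  \<open>m a\<^sup>m \<phi>\<^sub>2 (b / a) / D\<close> with \<open>D\<close> the right derivative of \<open>\<phi>\<^sub>1\<close> at 1, and by Bernoulli's inequality
  it is bounded by \<open>m a\<^sup>m \<phi>\<^sub>2 (b / a) / c\<close> for every \<open>\<epsilon> > 0\<close>. This bound is continuous in the direction,
  so dominated convergence applies.\<close>

section \<open>One-sided derivatives of convex functions\<close>

text \<open>Slopes from \<open>x\<close> decrease as \<open>t\<close> falls to \<open>x\<close>, and
  a chord to the left of \<open>x\<close> bounds them below. So they converge to their infimum,
  which is \<open>D\<close>; the second property later yields the sign of the derivative.\<close>

lemma convex_on_right_derivative:
  fixes f :: "real \<Rightarrow> real"
  assumes cvx: "convex_on S f" and S: "open S" "x \<in> S"
  obtains D where "((\<lambda>t. (f t - f x) / (t - x)) \<longlongrightarrow> D) (at_right x)"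
    "\<And>t. t \<in> S \<Longrightarrow> x < t \<Longrightarrow> D \<le> (f t - f x) / (t - x)"
proof -
  define q where "q t = (f t - f x) / (t - x)" for t
  have slope: "q s \<le> q t" if "x < s" "s < t" "t \<in> S" for s t
    using convex_on_slope_le(1)[OF cvx S(2) that(3,1,2)]
      minus_divide_divide[of "f s - f x" "s - x"] minus_divide_divide[of "f t - f x" "t - x"]
    by (simp add: q_def)
  obtain e where e: "e > 0" "ball x e \<subseteq> S"
    using S by (meson open_contains_ball)
  \<comment> \<open>Any point of \<open>S\<close> to the left of \<open>x\<close> would do: by
    convexity the slope from \<open>y\<close> to \<open>x\<close> is at most that from
    \<open>y\<close> to \<open>t\<close>, which is at most that from \<open>x\<close> to
    \<open>t\<close>.\<close>
  define y where "y = x - e / 2"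
  have y: "y \<in> S" "y < x"
    using e by (auto simp: y_def dist_real_def)
  have lower: "(f x - f y) / (x - y) \<le> q t" if "x < t" "t \<in> S" for t
    using order_trans[OF convex_on_slope_le[OF cvx y(1) that(2) y(2) that(1)]]
      minus_divide_divide[of "f x - f y" "x - y"] minus_divide_divide[of "f t - f x" "t - x"]
    by (simp add: q_def)
  define T where "T = {t \<in> S. x < t}"
  have ne: "T \<noteq> {}"
  proof -
    have "x + e / 2 \<in> T" using e by (auto simp: T_def dist_real_def)
    thus ?thesis by blast
  qed
  have bdd: "bdd_below (q ` T)"
    using lower by (auto simp: T_def intro!: bdd_belowI2[where m = "(f x - f y) / (x - y)"])
  define D where "D = Inf (q ` T)"
  have D: "D \<le> q t" if "t \<in> S" "x < t" for t
    unfolding D_def using bdd that by (intro cInf_lower) (auto simp: T_def)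
  have "(q \<longlongrightarrow> D) (at_right x)"
  proof (rule order_tendstoI)
    fix a assume "a < D"
    have "\<forall>\<^sub>F t in at_right x. t \<in> S \<and> x < t"
      using e by (auto simp: eventually_at_right_field dist_real_def intro!: exI[of _ "x + e"])
    thus "\<forall>\<^sub>F t in at_right x. a < q t"
      by eventually_elim (use D \<open>a < D\<close> in force)
  next
    fix a assume "D < a"
    \<comment> \<open>One slope below \<open>a\<close> suffices, since monotonicity passes the bound
      to every \<open>s\<close> between \<open>x\<close> and \<open>t\<close>.\<close>
    then obtain t where t: "t \<in> T" "q t < a"
      using ne bdd by (auto simp: D_def cInf_less_iff)
    have "\<forall>\<^sub>F s in at_right x. x < s \<and> s < t"
      using t by (auto simp: T_def eventually_at_right_field)
    thus "\<forall>\<^sub>F s in at_right x. q s < a"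
      by eventually_elim (use slope t in \<open>force simp: T_def\<close>)
  qed
  with D show ?thesis
    using that unfolding q_def by blast
qed

section \<open>Real-valued properties of Orlicz functions on the positive axis\<close>

context
  fixes \<phi> :: "real \<Rightarrow> ereal"
  assumes \<phi>: "\<phi> \<in> orlicz_class"
begin

lemma orlicz_class_ereal:
  assumes "x > 0"
  shows "\<phi> x = ereal (real_of_ereal (\<phi> x))"
proof -
  have "0 < \<phi> x" "\<phi> x < \<infinity>"
    using \<phi> assms by (auto simp: orlicz_class_def)
  thus ?thesis
    by (cases "\<phi> x") auto
qed

lemma orlicz_class_pos:
  assumes "x > 0"
  shows "0 < real_of_ereal (\<phi> x)"
proof -
  have "0 < \<phi> x"
    using \<phi> assms by (auto simp: orlicz_class_def)
  thus ?thesis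
    by (metis orlicz_class_ereal[OF assms] ereal_less(2))
qed

lemma orlicz_class_one: "real_of_ereal (\<phi> 1) = 1"
  using \<phi> by (simp add: orlicz_class_def)

lemma orlicz_class_strict_decreasing:
  assumes "0 < x" "x < y"
  shows "real_of_ereal (\<phi> y) < real_of_ereal (\<phi> x)"
proof -
  have "\<phi> y < \<phi> x"
    using \<phi> assms by (auto simp: orlicz_class_def monotone_on_def)
  thus ?thesis
    using assms by (metis orlicz_class_ereal ereal_less_eq(3) less_trans not_le)
qed

lemma orlicz_class_convex: "convex_on {0<..} (\<lambda>x. real_of_ereal (\<phi> x))"
proof (rule convex_onI)
  fix t x y :: real
  assume t: "0 < t" "t < 1" and xy: "x \<in> {0<..}" "y \<in> {0<..}"
  \<comment> \<open>With all three arguments positive every value is finite, so the extended-real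
    inequality becomes a real one.\<close>
  have pos: "0 < (1 - t) * x + t * y"
    using t xy by (intro add_pos_pos mult_pos_pos) auto
  have "\<phi> ((1 - t) * x + t * y) \<le> ereal (1 - t) * \<phi> x + ereal t * \<phi> y"
    using \<phi> t xy by (auto simp: orlicz_class_def)
  hence "ereal (real_of_ereal (\<phi> ((1 - t) * x + t * y)))
      \<le> ereal ((1 - t) * real_of_ereal (\<phi> x) + t * real_of_ereal (\<phi> y))"
    using pos xy by (metis orlicz_class_ereal greaterThan_iff plus_ereal.simps(1) times_ereal.simps(1))
  thus "real_of_ereal (\<phi> ((1 - t) *\<^sub>R x + t *\<^sub>R y))
      \<le> (1 - t) * real_of_ereal (\<phi> x) + t * real_of_ereal (\<phi> y)"
    by simp
qed simp

lemma orlicz_class_continuous: "continuous_on {0<..} (\<lambda>x. real_of_ereal (\<phi> x))"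
  by (intro convex_on_continuous orlicz_class_convex) auto

lemma orlicz_class_right_deriv:
  shows "((\<lambda>t. (real_of_ereal (\<phi> t) - 1) / (t - 1)) \<longlongrightarrow> right_deriv \<phi> 1) (at_right 1)"
    and "right_deriv \<phi> 1 < 0"
proof -
  obtain D where D: "((\<lambda>t. (real_of_ereal (\<phi> t) - real_of_ereal (\<phi> 1)) / (t - 1)) \<longlongrightarrow> D) (at_right 1)"
      "\<And>t. t \<in> {0<..} \<Longrightarrow> 1 < t \<Longrightarrow> D \<le> (real_of_ereal (\<phi> t) - real_of_ereal (\<phi> 1)) / (t - 1)"
    using convex_on_right_derivative[OF orlicz_class_convex, of 1] by auto
  have eq: "right_deriv \<phi> 1 = D"
    unfolding right_deriv_def using D(1) by (intro tendsto_Lim) auto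
  show "((\<lambda>t. (real_of_ereal (\<phi> t) - 1) / (t - 1)) \<longlongrightarrow> right_deriv \<phi> 1) (at_right 1)"
    using D(1) by (simp add: eq orlicz_class_one)
  \<comment> \<open>The derivative is at most the slope from 1 to 2, which is negative by strict
    decrease.\<close>
  show "right_deriv \<phi> 1 < 0"
    using D(2)[of 2] orlicz_class_strict_decreasing[of 1 2] by (simp add: eq)
qed

text \<open>Convexity alone gives the factor \<open>s - 1\<close> for \<open>s \<le> 2\<close>; weakening it to the bounded
  \<open>1 - 1 / s\<close> makes the estimate valid for all \<open>s \<ge> 1\<close>.\<close>

lemma orlicz_class_gap:
  assumes "1 \<le> s"
  shows "(1 - real_of_ereal (\<phi> 2)) * (1 - 1 / s) \<le> 1 - real_of_ereal (\<phi> s)"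
proof -
  let ?f = "\<lambda>x. real_of_ereal (\<phi> x)"
  have c: "0 < 1 - ?f 2"
    using orlicz_class_strict_decreasing[of 1 2] by (simp add: orlicz_class_one)
  show ?thesis
  proof (cases "s \<le> 2")
    case True
    have "?f ((1 - (s - 1)) *\<^sub>R 1 + (s - 1) *\<^sub>R 2) \<le> (1 - (s - 1)) * ?f 1 + (s - 1) * ?f 2"
      using assms True by (intro convex_onD[OF orlicz_class_convex]) auto
    hence "(1 - ?f 2) * (s - 1) \<le> 1 - ?f s"
      by (simp add: orlicz_class_one algebra_simps)
    moreover have "1 - 1 / s \<le> s - 1"
    proof -
      have "s - 1 - (1 - 1 / s) = (s - 1)\<^sup>2 / s"
        using assms by (simp add: field_simps power2_eq_square)
      thus ?thesis
        using assms by (smt (verit) divide_nonneg_nonneg zero_le_power2)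
    qed
    ultimately show ?thesis
      using c by (smt (verit) mult_left_mono)
  next
    case False
    have "(1 - ?f 2) * (1 - 1 / s) \<le> (1 - ?f 2) * 1"
      using c assms by (intro mult_left_mono) auto
    also have "\<dots> \<le> 1 - ?f s"
      using False orlicz_class_strict_decreasing[of 2 s] by simp
    finally show ?thesis .
  qed
qed

end

section \<open>Half chords of star bodies\<close>

context
  fixes K :: "(real^'n) set"
  assumes K: "star_body K"
begin

lemma half_chord_pos: "u \<in> sphere 0 1 \<Longrightarrow> 0 < half_chord K u"
  using K by (auto simp: half_chord_def star_body_def intro!: add_pos_pos divide_pos_pos)

lemma continuous_on_half_chord: "continuous_on (sphere 0 1) (half_chord K)"
proof -
  have *: "continuous_on (sphere 0 1) (radial K)"
    using K by (simp add: star_body_def)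
  have "continuous_on (sphere 0 1) (\<lambda>u. radial K (- u))"
    by (rule continuous_on_compose2[OF *]) (auto intro!: continuous_intros)
  with * show ?thesis
    unfolding half_chord_def by (intro continuous_intros) auto
qed

end

section \<open>Integrability on the sphere\<close>

text \<open>The truncated cone over the whole sphere lies in the unit ball, which has finite
  volume.\<close>

lemma finite_measure_sphere_measure: "finite_measure (sphere_measure :: (real^'n) measure)"
proof (rule finite_measureI)
  let ?C = "{r *\<^sub>R u |r u. 0 < r \<and> r \<le> 1 \<and> u \<in> (sphere 0 1 :: (real^'n) set)}"
  have "emeasure lborel ?C \<le> emeasure lborel (cball 0 1 :: (real^'n) set)"
    by (rule emeasure_mono) auto
  also have "\<dots> < \<infinity>"
    by (rule emeasure_lborel_cball_finite)
  finally have "emeasure lborel ?C < \<infinity>" .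
  moreover have "emeasure sphere_measure (sphere 0 1 :: (real^'n) set)
      = of_nat CARD('n) * emeasure lborel ?C"
    using sets.top[of "sphere_measure :: (real^'n) measure"]
    by (intro emeasure_sphere_measure) simp
  ultimately show "emeasure sphere_measure (space (sphere_measure :: (real^'n) measure)) \<noteq> \<infinity>"
    by (auto simp: ennreal_mult_eq_top_iff less_top)
qed

lemma integrable_sphere_measure_continuous:
  fixes f :: "real^'n \<Rightarrow> real"
  assumes "continuous_on (sphere 0 1) f"
  shows "integrable sphere_measure f"
proof -
  interpret finite_measure "sphere_measure :: (real^'n) measure"
    by (rule finite_measure_sphere_measure)
  have "bounded (f ` sphere 0 1)"
    using assms by (intro compact_imp_bounded compact_continuous_image) auto
  then obtain B where B: "\<And>u. u \<in> sphere 0 1 \<Longrightarrow> norm (f u) \<le> B"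
    unfolding bounded_iff by blast
  have "f \<in> borel_measurable (restrict_space borel (sphere 0 1))"
    using assms by (intro borel_measurable_continuous_on_restrict)
  hence "f \<in> borel_measurable sphere_measure"
    using measurable_cong_sets[OF sets_sphere_measure refl] by blast
  thus ?thesis
    using B by (intro integrable_const_bound[of f B]) auto
qed

section \<open>Estimates in a fixed direction\<close>

context
  fixes \<phi>1 \<phi>2 :: "real \<Rightarrow> ereal" and a b \<epsilon> x :: real
  assumes \<phi>1: "\<phi>1 \<in> orlicz_class" and \<phi>2: "\<phi>2 \<in> orlicz_class"
    and pos: "0 < a" "0 < b" "0 < \<epsilon>" "0 < x"
    and eq: "\<phi>1 (a / x) + ereal \<epsilon> * \<phi>2 (b / x) = 1"
begin

lemma orlicz_combination_real:
  "real_of_ereal (\<phi>1 (a / x)) = 1 - \<epsilon> * real_of_ereal (\<phi>2 (b / x))"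
proof -
  have "\<phi>1 (a / x) = ereal (real_of_ereal (\<phi>1 (a / x)))"
       "\<phi>2 (b / x) = ereal (real_of_ereal (\<phi>2 (b / x)))"
    using pos \<phi>1 \<phi>2 by (auto intro!: orlicz_class_ereal)
  with eq have "ereal (real_of_ereal (\<phi>1 (a / x)) + \<epsilon> * real_of_ereal (\<phi>2 (b / x))) = ereal 1"
    by (metis one_ereal_def plus_ereal.simps(1) times_ereal.simps(1))
  thus ?thesis by simp
qed

text \<open>Otherwise \<open>a / x \<le> 1\<close> makes the first term at least 1, while the second
  term is positive, so the sum exceeds 1.\<close>

lemma orlicz_combination_less: "x < a"
proof (rule ccontr)
  assume "\<not> x < a"
  hence "a / x \<le> 1"
    using pos by simp
  hence "1 \<le> real_of_ereal (\<phi>1 (a / x))"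
    using orlicz_class_strict_decreasing[OF \<phi>1, of "a / x" 1] orlicz_class_one[OF \<phi>1] pos
    by (cases "a / x = 1") auto
  moreover have "0 < \<epsilon> * real_of_ereal (\<phi>2 (b / x))"
    using orlicz_class_pos[OF \<phi>2] pos by (intro mult_pos_pos) auto
  ultimately show False
    using orlicz_combination_real by simp
qed

lemma orlicz_combination_gap:
  "(1 - real_of_ereal (\<phi>1 2)) * (1 - x / a) \<le> \<epsilon> * real_of_ereal (\<phi>2 (b / a))"
proof -
  have "b / a < b / x"
    using pos orlicz_combination_less by (simp add: divide_strict_left_mono)
  hence "real_of_ereal (\<phi>2 (b / x)) \<le> real_of_ereal (\<phi>2 (b / a))"
    using orlicz_class_strict_decreasing[OF \<phi>2, of "b / a" "b / x"] pos by simp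
  hence "\<epsilon> * real_of_ereal (\<phi>2 (b / x)) \<le> \<epsilon> * real_of_ereal (\<phi>2 (b / a))"
    using pos by simp
  moreover have "(1 - real_of_ereal (\<phi>1 2)) * (1 - 1 / (a / x)) \<le> 1 - real_of_ereal (\<phi>1 (a / x))"
    using pos orlicz_combination_less by (intro orlicz_class_gap[OF \<phi>1]) simp
  ultimately show ?thesis
    using orlicz_combination_real by simp
qed

text \<open>Bernoulli's inequality reduces the power difference to \<open>1 - x / a\<close>, which
  is of order \<open>\<epsilon>\<close> by the gap estimate. The bound is free of
  \<open>\<epsilon>\<close> and \<open>x\<close>, so it can dominate.\<close>

lemma orlicz_combination_power_bound:
  "\<bar>(x ^ m - a ^ m) / \<epsilon>\<bar>
     \<le> real m * a ^ m * real_of_ereal (\<phi>2 (b / a)) / (1 - real_of_ereal (\<phi>1 2))"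
proof -
  define c where "c = 1 - real_of_ereal (\<phi>1 2)"
  have c: "0 < c"
    using orlicz_class_strict_decreasing[OF \<phi>1, of 1 2] orlicz_class_one[OF \<phi>1] by (simp add: c_def)
  have "1 + real m * (x / a - 1) \<le> (1 + (x / a - 1)) ^ m"
    using pos by (intro Bernoulli_inequality) simp
  hence "a ^ m * (1 - (x / a) ^ m) \<le> a ^ m * (real m * (1 - x / a))"
    using pos by (intro mult_left_mono) (auto simp: algebra_simps)
  hence "a ^ m - x ^ m \<le> real m * a ^ m * (1 - x / a)"
    using pos by (simp add: power_divide algebra_simps)
  also have "\<dots> \<le> real m * a ^ m * (\<epsilon> * real_of_ereal (\<phi>2 (b / a)) / c)"
    using pos c orlicz_combination_gap
    by (intro mult_left_mono) (auto simp: c_def field_simps)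
  finally have "(a ^ m - x ^ m) / \<epsilon> \<le> real m * a ^ m * real_of_ereal (\<phi>2 (b / a)) / c"
    using pos by (simp add: field_simps)
  moreover have "x ^ m \<le> a ^ m"
    using pos orlicz_combination_less by (intro power_mono) auto
  hence "\<bar>(x ^ m - a ^ m) / \<epsilon>\<bar> = (a ^ m - x ^ m) / \<epsilon>"
    using pos by (simp add: abs_divide)
  ultimately show ?thesis
    by (simp add: c_def)
qed

end

section \<open>The pointwise limit\<close>

text \<open>The quotient is \<open>(x \<epsilon> - a) / \<epsilon>\<close> times a sum of powers.
  The defining equation rewrites the first factor as \<open>x \<epsilon>\<close> times the
  \<open>\<phi>2\<close> value, divided by the slope \<open>q (a / x \<epsilon>)\<close>; each piece
  then has a limit.\<close>

lemma orlicz_combination_tendsto: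
  fixes x :: "real \<Rightarrow> real"
  assumes \<phi>1: "\<phi>1 \<in> orlicz_class" and \<phi>2: "\<phi>2 \<in> orlicz_class"
    and ab: "0 < a" "0 < b" and x: "\<And>\<epsilon>. 0 < \<epsilon> \<Longrightarrow> 0 < x \<epsilon>"
    and eq: "\<And>\<epsilon>. 0 < \<epsilon> \<Longrightarrow> \<phi>1 (a / x \<epsilon>) + ereal \<epsilon> * \<phi>2 (b / x \<epsilon>) = 1"
  shows "((\<lambda>\<epsilon>. (x \<epsilon> ^ m - a ^ m) / \<epsilon>) \<longlongrightarrow>
           real m * a ^ m * real_of_ereal (\<phi>2 (b / a)) / right_deriv \<phi>1 1) (at_right 0)"
proof -
  define D where "D = right_deriv \<phi>1 1"
  define c where "c = 1 - real_of_ereal (\<phi>1 2)"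
  define g where "g = real_of_ereal (\<phi>2 (b / a))"
  define q where "q t = (real_of_ereal (\<phi>1 t) - 1) / (t - 1)" for t
  have c: "0 < c"
    using orlicz_class_strict_decreasing[OF \<phi>1, of 1 2] orlicz_class_one[OF \<phi>1] by (simp add: c_def)
  have D: "D < 0" "(q \<longlongrightarrow> D) (at_right 1)"
    using orlicz_class_right_deriv[OF \<phi>1] unfolding D_def q_def by auto
  have ev: "\<forall>\<^sub>F \<epsilon> in at_right 0. (0::real) < \<epsilon>"
    by (simp add: eventually_at_right_less)
  have less: "x \<epsilon> < a" if "0 < \<epsilon>" for \<epsilon>
    using orlicz_combination_less[OF \<phi>1 \<phi>2 ab that x[OF that] eq[OF that]] .
  have lim_x: "(x \<longlongrightarrow> a) (at_right 0)"
  proof (rule tendsto_sandwich)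
    show "\<forall>\<^sub>F \<epsilon> in at_right 0. a - a * (\<epsilon> * g / c) \<le> x \<epsilon>"
      using ev
    proof eventually_elim
      case (elim \<epsilon>)
      have "c * (1 - x \<epsilon> / a) \<le> \<epsilon> * g"
        unfolding c_def g_def
        using orlicz_combination_gap[OF \<phi>1 \<phi>2 ab elim x[OF elim] eq[OF elim]] .
      hence "a * (1 - x \<epsilon> / a) \<le> a * (\<epsilon> * g / c)"
        using c ab by (intro mult_left_mono) (auto simp: field_simps)
      thus ?case
        using ab by (simp add: algebra_simps)
    qed
    show "\<forall>\<^sub>F \<epsilon> in at_right 0. x \<epsilon> \<le> a"
      using ev by eventually_elim (use less in force)
    have "((\<lambda>\<epsilon>. a - a * (\<epsilon> * g / c)) \<longlongrightarrow> a - a * (0 * g / c)) (at_right 0)"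
      using c by (intro tendsto_intros) auto
    thus "((\<lambda>\<epsilon>. a - a * (\<epsilon> * g / c)) \<longlongrightarrow> a) (at_right 0)" by simp
  qed auto
  have lim_ratio: "((\<lambda>\<epsilon>. a / x \<epsilon>) \<longlongrightarrow> a / a) (at_right 0)"
    using ab by (intro tendsto_intros lim_x) auto
  \<comment> \<open>Strictness of \<open>x \<epsilon> < a\<close> keeps the ratio above 1, so the
    one-sided limit of \<open>q\<close> applies.\<close>
  have "filterlim (\<lambda>\<epsilon>. a / x \<epsilon>) (at_right 1) (at_right 0)"
    unfolding filterlim_at
  proof
    show "\<forall>\<^sub>F \<epsilon> in at_right 0. a / x \<epsilon> \<in> {1<..} \<and> a / x \<epsilon> \<noteq> 1"
      using ev
    proof eventually_elim
      case (elim \<epsilon>)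
      show ?case
        using x[OF elim] less[OF elim] by simp
    qed
  qed (use lim_ratio ab in simp)
  hence lim_q: "((\<lambda>\<epsilon>. q (a / x \<epsilon>)) \<longlongrightarrow> D) (at_right 0)"
    by (rule filterlim_compose[OF D(2)])
  have "isCont (\<lambda>t. real_of_ereal (\<phi>2 t)) (b / a)"
    using orlicz_class_continuous[OF \<phi>2] ab by (simp add: continuous_on_eq_continuous_at)
  moreover have "((\<lambda>\<epsilon>. b / x \<epsilon>) \<longlongrightarrow> b / a) (at_right 0)"
    using ab by (intro tendsto_intros lim_x) auto
  ultimately have lim_g: "((\<lambda>\<epsilon>. real_of_ereal (\<phi>2 (b / x \<epsilon>))) \<longlongrightarrow> g) (at_right 0)"
    unfolding g_def by (rule isCont_tendsto_compose)
  \<comment> \<open>The cofactor in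
    \<open>x \<epsilon> ^ m - a ^ m = (x \<epsilon> - a) * P \<epsilon>\<close>.\<close>
  define P where "P \<epsilon> = (\<Sum>j<m. a ^ (m - Suc j) * x \<epsilon> ^ j)" for \<epsilon>
  have "(P \<longlongrightarrow> (\<Sum>j<m. a ^ (m - Suc j) * a ^ j)) (at_right 0)"
    unfolding P_def by (intro tendsto_intros lim_x)
  also have "(\<Sum>j<m. a ^ (m - Suc j) * a ^ j) = (\<Sum>j<m. a ^ (m - 1))"
    by (intro sum.cong) (auto simp flip: power_add)
  finally have lim_P: "(P \<longlongrightarrow> real m * a ^ (m - 1)) (at_right 0)"
    by simp
  have "((\<lambda>\<epsilon>. x \<epsilon> * real_of_ereal (\<phi>2 (b / x \<epsilon>)) / q (a / x \<epsilon>) * P \<epsilon>)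
      \<longlongrightarrow> a * g / D * (real m * a ^ (m - 1))) (at_right 0)"
    using D(1) by (intro tendsto_intros lim_x lim_g lim_q lim_P) auto
  also have "a * g / D * (real m * a ^ (m - 1)) = real m * a ^ m * g / D"
    \<comment> \<open>For \<open>m = 0\<close> the truncated exponent \<open>m - 1\<close> is
      harmless, as the factor \<open>real m\<close> vanishes on both sides.\<close>
    by (cases m) auto
  finally have "((\<lambda>\<epsilon>. x \<epsilon> * real_of_ereal (\<phi>2 (b / x \<epsilon>)) / q (a / x \<epsilon>) * P \<epsilon>)
      \<longlongrightarrow> real m * a ^ m * g / D) (at_right 0)" .
  moreover have "\<forall>\<^sub>F \<epsilon> in at_right 0.
      x \<epsilon> * real_of_ereal (\<phi>2 (b / x \<epsilon>)) / q (a / x \<epsilon>) * P \<epsilon> = (x \<epsilon> ^ m - a ^ m) / \<epsilon>"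
    using ev
  proof eventually_elim
    case (elim \<epsilon>)
    define h where "h = real_of_ereal (\<phi>2 (b / x \<epsilon>))"
    have h: "0 < h"
      using orlicz_class_pos[OF \<phi>2] ab x elim by (simp add: h_def)
    have "a / x \<epsilon> - 1 = (a - x \<epsilon>) / x \<epsilon>"
      using x[OF elim] by (simp add: diff_divide_distrib)
    \<comment> \<open>The numerator of \<open>q\<close> is \<open>- \<epsilon> * h\<close> by the
      defining equation.\<close>
    hence "q (a / x \<epsilon>) = - \<epsilon> * h * x \<epsilon> / (a - x \<epsilon>)"
      using orlicz_combination_real[OF \<phi>1 \<phi>2 ab elim x[OF elim] eq[OF elim]]
      by (simp add: q_def h_def)
    hence "x \<epsilon> * h / q (a / x \<epsilon>) = x \<epsilon> * h / (- \<epsilon> * h * x \<epsilon> / (a - x \<epsilon>))"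
      by (rule arg_cong)
    also have "\<dots> = (x \<epsilon> - a) / \<epsilon>"
      using h x[OF elim] less[OF elim] elim by (simp add: field_simps)
    finally have "x \<epsilon> * h / q (a / x \<epsilon>) = (x \<epsilon> - a) / \<epsilon>" .
    thus ?case
      by (simp add: P_def h_def power_diff_sumr2)
  qed
  ultimately show ?thesis
    unfolding g_def D_def by (rule Lim_transform_eventually)
qed

section \<open>Dominated convergence over the sphere\<close>

theorem lemma4p4:
  fixes K L :: "(real^'n) set" and M :: "real \<Rightarrow> (real^'n) set"
    and i :: nat and \<phi>1 \<phi>2 :: "real \<Rightarrow> ereal"
  assumes "CARD('n) \<ge> 2"
    and "star_body K" and "star_body L"
    and "i < CARD('n)"
    and "\<phi>1 \<in> orlicz_class" and "\<phi>2 \<in> orlicz_class"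
    and "\<And>\<epsilon>. \<epsilon> > 0 \<Longrightarrow> orlicz_chord_combination \<phi>1 \<phi>2 K \<epsilon> L (M \<epsilon>)"
  shows "\<exists>l. ((\<lambda>\<epsilon>. (chord_integral i (M \<epsilon>) - chord_integral i K) / \<epsilon>) \<longlongrightarrow> l) (at_right 0) \<and>
           right_deriv \<phi>1 1 / (real CARD('n) - real i) * l =
             1 / CARD('n) * (\<integral>u. real_of_ereal (\<phi>2 (half_chord L u / half_chord K u))
                                 * half_chord K u ^ (CARD('n) - i) \<partial>sphere_measure)"
proof -
  define m where "m = CARD('n) - i"
  define a where "a = half_chord K"
  define b where "b = half_chord L"
  define x where "x \<epsilon> = half_chord (M \<epsilon>)" for \<epsilon>
  define D where "D = right_deriv \<phi>1 1"
  define g where "g u = real_of_ereal (\<phi>2 (b u / a u))" for u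
  \<comment> \<open>\<open>F\<close> is the pointwise limit of the quotients
    \<open>s \<epsilon>\<close>, and \<open>w\<close> dominates them for every positive
    \<open>\<epsilon>\<close>.\<close>
  define F where "F u = real m * a u ^ m * g u / D" for u
  define w where "w u = real m * a u ^ m * g u / (1 - real_of_ereal (\<phi>1 2))" for u
  define s where "s \<epsilon> u = (x \<epsilon> u ^ m - a u ^ m) / \<epsilon>" for \<epsilon> u
  have m: "real m = real CARD('n) - real i" "0 < m"
    using assms(4) by (auto simp: m_def of_nat_diff)
  have D: "D < 0"
    unfolding D_def by (rule orlicz_class_right_deriv[OF assms(5)])
  have star_M: "star_body (M \<epsilon>)" if "0 < \<epsilon>" for \<epsilon>
    using assms(7)[OF that] by (simp add: orlicz_chord_combination_def)
  have eq: "\<phi>1 (a u / x \<epsilon> u) + ereal \<epsilon> * \<phi>2 (b u / x \<epsilon> u) = 1"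
    if "0 < \<epsilon>" "u \<in> sphere 0 1" for \<epsilon> u
    using assms(7)[OF that(1)] that(2) unfolding orlicz_chord_combination_def a_def b_def x_def by blast
  have pos: "0 < a u" "0 < b u" if "u \<in> sphere 0 1" for u
    using that assms(2,3) by (simp_all only: a_def b_def half_chord_pos)
  have xpos: "0 < x \<epsilon> u" if "0 < \<epsilon>" "u \<in> sphere 0 1" for \<epsilon> u
    using half_chord_pos[OF star_M[OF that(1)] that(2)] by (simp add: x_def)
  have cont_a: "continuous_on (sphere 0 1) a" and cont_b: "continuous_on (sphere 0 1) b"
    using assms(2,3) by (auto simp: a_def b_def continuous_on_half_chord)
  have cont_x: "continuous_on (sphere 0 1) (x \<epsilon>)" if "0 < \<epsilon>" for \<epsilon>
    using continuous_on_half_chord[OF star_M[OF that]] by (simp add: x_def)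
  have cont_g: "continuous_on (sphere 0 1) g"
    unfolding g_def
  proof (rule continuous_on_compose2[OF orlicz_class_continuous[OF assms(6)]])
    show "continuous_on (sphere 0 1) (\<lambda>u. b u / a u)"
      using pos(1) by (intro continuous_intros cont_a cont_b) force
    show "(\<lambda>u. b u / a u) ` sphere 0 1 \<subseteq> {0<..}"
      using pos by auto
  qed
  have int_F: "integrable sphere_measure F" and int_w: "integrable sphere_measure w"
    \<comment> \<open>Division by a constant becomes multiplication by a constant, so continuity
      needs no nonvanishing condition.\<close>
    unfolding F_def w_def divide_inverse
    by (intro integrable_sphere_measure_continuous continuous_intros cont_a cont_g)+
  have int_a: "integrable sphere_measure (\<lambda>u. a u ^ m)"
    by (intro integrable_sphere_measure_continuous continuous_intros cont_a)
  have int_x: "integrable sphere_measure (\<lambda>u. x \<epsilon> u ^ m)" if "0 < \<epsilon>" for \<epsilon>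
    by (intro integrable_sphere_measure_continuous continuous_intros cont_x that)
  have lim: "((\<lambda>\<epsilon>. \<integral>u. s \<epsilon> u \<partial>sphere_measure) \<longlongrightarrow> (\<integral>u. F u \<partial>sphere_measure)) (at_right 0)"
    \<comment> \<open>Dominated convergence is applied along an arbitrary positive null
      sequence.\<close>
    unfolding tendsto_at_iff_sequentially
  proof (intro allI impI, unfold o_def)
    fix X :: "nat \<Rightarrow> real"
    assume X: "\<forall>k. X k \<in> {0<..} - {0}" "X \<longlonglongrightarrow> 0"
    hence X0: "0 < X k" for k by auto
    have flim: "filterlim X (at_right 0) sequentially"
      unfolding filterlim_at using X(2) by (simp add: X0 less_imp_neq[OF X0, symmetric])
    show "(\<lambda>k. \<integral>u. s (X k) u \<partial>sphere_measure) \<longlonglongrightarrow> (\<integral>u. F u \<partial>sphere_measure)"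
    proof (rule integral_dominated_convergence[where w = w])
      show "F \<in> borel_measurable sphere_measure"
        using int_F by auto
      show "s (X k) \<in> borel_measurable sphere_measure" for k
        unfolding s_def using int_a int_x[OF X0] by auto
      show "integrable sphere_measure w" by (rule int_w)
      show "AE u in sphere_measure. (\<lambda>k. s (X k) u) \<longlonglongrightarrow> F u"
      proof (rule AE_I2)
        fix u :: "real^'n" assume "u \<in> space sphere_measure"
        hence u: "u \<in> sphere 0 1" by simp
        have "((\<lambda>\<epsilon>. s \<epsilon> u) \<longlongrightarrow> F u) (at_right 0)"
          unfolding s_def F_def g_def D_def
          by (rule orlicz_combination_tendsto[OF assms(5,6) pos[OF u]]) (use xpos eq u in auto)
        thus "(\<lambda>k. s (X k) u) \<longlonglongrightarrow> F u"
          using flim by (rule filterlim_compose)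
      qed
      show "AE u in sphere_measure. norm (s (X k) u) \<le> w u" for k
      proof (rule AE_I2)
        fix u :: "real^'n" assume "u \<in> space sphere_measure"
        hence u: "u \<in> sphere 0 1" by simp
        show "norm (s (X k) u) \<le> w u"
          unfolding s_def w_def g_def real_norm_def
          using orlicz_combination_power_bound[OF assms(5,6) pos[OF u] X0 xpos[OF X0 u] eq[OF X0 u]] .
      qed
    qed
  qed
  define l where "l = 1 / real CARD('n) * (\<integral>u. F u \<partial>sphere_measure)"
  have "((\<lambda>\<epsilon>. 1 / real CARD('n) * (\<integral>u. s \<epsilon> u \<partial>sphere_measure)) \<longlongrightarrow> l) (at_right 0)"
    unfolding l_def by (intro tendsto_intros lim)
  moreover have "\<forall>\<^sub>F \<epsilon> in at_right 0. 1 / real CARD('n) * (\<integral>u. s \<epsilon> u \<partial>sphere_measure)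
      = (chord_integral i (M \<epsilon>) - chord_integral i K) / \<epsilon>"
    using eventually_at_right_less[of 0]
  proof eventually_elim
    case (elim \<epsilon>)
    show ?case
      \<comment> \<open>Integrability of both powers lets the integral of the difference split into
        the two chord integrals.\<close>
      unfolding s_def using int_a int_x[OF elim]
      by (simp add: chord_integral_def flip: a_def x_def m_def) (simp add: diff_divide_distrib)
  qed
  ultimately have "((\<lambda>\<epsilon>. (chord_integral i (M \<epsilon>) - chord_integral i K) / \<epsilon>) \<longlongrightarrow> l) (at_right 0)"
    by (rule Lim_transform_eventually)
  moreover have "D / (real CARD('n) - real i) * l
      = 1 / CARD('n) * (\<integral>u. g u * a u ^ m \<partial>sphere_measure)"
  proof -
    \<comment> \<open>The constant \<open>real m / D\<close> leaves the integral and cancels against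
      \<open>D / (real CARD('n) - real i)\<close>, as \<open>D\<close> and \<open>m\<close> are
      nonzero.\<close>
    have "F = (\<lambda>u. real m / D * (g u * a u ^ m))"
      by (simp add: F_def fun_eq_iff)
    hence "l = 1 / CARD('n) * (real m / D * (\<integral>u. g u * a u ^ m \<partial>sphere_measure))"
      by (simp add: l_def)
    thus ?thesis
      using D m(2) by (simp flip: m(1))
  qed
  ultimately show ?thesis
    unfolding D_def g_def a_def b_def m_def by blast
qed

end
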